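(* Let $S\subset\mathbb{R}^n$ be a nonempty closed set that is not reduced to a singleton, with $S\neq\mathbb{R}^n$, and let $r>0$. Then $S$ is $r$-strongly convex if and only if $S$ is bounded, $\operatorname{int} S\neq\emptyset$, and the set $\operatorname{bdry} S$ is $r$-spherically supported.
   Context: $\mathbb{R}^n$ carries the usual inner product $\langle\cdot,\cdot\rangle$ and Euclidean norm $\|\cdot\|$; $\operatorname{int}$ and $\operatorname{bdry}$ denote topological interior and boundary. For a nonempty closed set $C\subset\mathbb{R}^n$ and $s\in C$, the proximal normal cone to $C$ at $s$ is $$N_C^P(s):=\{\zeta\in\mathbb{R}^n : \exists\,\sigma\ge 0 \text{ such that } \langle\zeta,x-s\rangle\le\sigma\|x-s\|^2\ \text{for all } x\in C\}.$$ For $s\in\operatorname{bdry} C$ and $r>0$, a nonzero vector $\zeta\in N_C^P(s)$ is said to be far realized by an $r$-sphere (with respect to $C$) if $$\left\langle\frac{\zeta}{\|\zeta\|},x-s\right\rangle\le-\frac{1}{2r}\|x-s\|^2\quad\text{for all } x\in C,$$ equivalently, $C$ is contained in the closed ball of radius $r$ centered at $s-r\,\zeta/\|\zeta\|$. A nonempty closed set $C$ is $r$-spherically supported if for every $s\in\operatorname{bdry} C$ there exists a nonzero vector $\zeta\in N_C^P(s)$ that is far realized by an $r$-sphere. In the theorem this definition is applied to the closed set $C=\operatorname{bdry} S$ (with proximal normal cones taken with respect to $\operatorname{bdry} S$). A nonempty closed set $C$ is $r$-strongly convex if for every $s\in\operatorname{bdry} C$, every nonzero vector $\zeta\in N_C^P(s)$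 is far realized by an $r$-sphere. *)

theory Defs
  imports "HOL-Analysis.Analysis"
begin

definition proximal_normal_cone :: "'a::real_inner set \<Rightarrow> 'a \<Rightarrow> 'a set" where
  "proximal_normal_cone C s =
     {\<zeta>. \<exists>\<sigma>\<ge>0. \<forall>x\<in>C. \<zeta> \<bullet> (x - s) \<le> \<sigma> * (norm (x - s))\<^sup>2}"

(* Only meaningful for r > 0, s in the boundary of C and a nonzero proximal normal \<zeta>;
   these conditions are imposed wherever the predicate is used. *)
definition far_realized :: "real \<Rightarrow> 'a::real_inner set \<Rightarrow> 'a \<Rightarrow> 'a \<Rightarrow> bool" where
  "far_realized r C s \<zeta> \<longleftrightarrow>
     (\<forall>x\<in>C. (\<zeta> /\<^sub>R norm \<zeta>) \<bullet> (x - s) \<le> - (1 / (2 * r)) * (norm (x - s))\<^sup>2)"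

definition spherically_supported :: "real \<Rightarrow> 'a::real_inner set \<Rightarrow> bool" where
  "spherically_supported r C \<longleftrightarrow> C \<noteq> {} \<and> closed C \<and>
     (\<forall>s\<in>frontier C. \<exists>\<zeta>\<in>proximal_normal_cone C s. \<zeta> \<noteq> 0 \<and> far_realized r C s \<zeta>)"

definition strongly_convex :: "real \<Rightarrow> 'a::real_inner set \<Rightarrow> bool" where
  "strongly_convex r C \<longleftrightarrow> C \<noteq> {} \<and> closed C \<and>
     (\<forall>s\<in>frontier C. \<forall>\<zeta>\<in>proximal_normal_cone C s. \<zeta> \<noteq> 0 \<longrightarrow> far_realized r C s \<zeta>)"

end

theory Submission
  imports Defs
begin

text \<open>
  Everything rests on one reading of the definitions: a unit vector \<open>u\<close> is far realized by an
  \<open>r\<close>-sphere at \<open>s\<close> exactly when the set lies in the closed ball of radius \<open>r\<close> centred at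
  \<open>s - r u\<close>, a ball that has \<open>s\<close> on its bounding sphere (\<open>far_realized_iff_subset_cball\<close>).

  From strong convexity to support. A point outside \<open>S\<close> minus a nearest point of \<open>S\<close> is a proximal
  normal at that nearest point, so the nearest points of outside points carry a supporting
  \<open>r\<close>-ball. These nearest points are dense in the boundary, and supporting balls survive limits by
  compactness of the unit sphere; hence every boundary point has one
  (\<open>strongly_convex_far_normal\<close>). The ball bounds \<open>S\<close>, and it supports \<open>frontier S\<close> as well. The
  same nearest-point normals show that \<open>S\<close> contains midpoints. If the interior were empty, the
  midpoint of two distinct points of \<open>S\<close> would be a boundary point, and so would lie on the bounding
  sphere of a ball that contains both, against the strict convexity of balls.

  From support to strong convexity. A bounded set whose boundary lies in a ball lies in that ball,
  so the balls that support \<open>frontier S\<close> contain \<open>S\<close>. Since \<open>S\<close> has an interior point, a segment from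
  it to a point outside \<open>S\<close> crosses the boundary at a point whose ball excludes the outside point;
  thus \<open>S\<close> is an intersection of balls of radius \<open>r\<close>. By the parallelogram identity
  (\<open>convex_combination_cball_subset\<close>), any such intersection contains, with \<open>a\<close> and \<open>b\<close>, the ball of
  radius \<open>t (1 - t) \<parallel>b - a\<parallel>\<^sup>2 / (2 r)\<close> around \<open>a + t (b - a)\<close>. Testing a proximal normal at \<open>a\<close> on
  the point of this small ball that is farthest in the direction of the normal, and letting \<open>t\<close> tend
  to \<open>0\<close>, removes the quadratic error term of the proximal inequality and leaves the far realization
  inequality (\<open>far_realized_if_convex_combination_cballs\<close>).
\<close>

section \<open>Far realization and supporting balls\<close>

lemma far_inequality_iff_cball:
  fixes u :: "'a::real_inner"
  assumes "norm u = 1" and "r > 0"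
  shows "u \<bullet> (x - s) \<le> - (1 / (2 * r)) * (norm (x - s))\<^sup>2 \<longleftrightarrow> x \<in> cball (s - r *\<^sub>R u) r"
proof -
  have uu: "u \<bullet> u = 1"
    using assms(1) by (simp add: dot_square_norm)
  have "x \<in> cball (s - r *\<^sub>R u) r \<longleftrightarrow> norm ((x - s) + r *\<^sub>R u) \<le> r"
    by (simp add: dist_norm norm_minus_commute algebra_simps)
  also have "\<dots> \<longleftrightarrow> (norm ((x - s) + r *\<^sub>R u))\<^sup>2 \<le> r\<^sup>2"
    using assms(2) by (simp add: power_mono_iff)
  also have "(norm ((x - s) + r *\<^sub>R u))\<^sup>2 = (norm (x - s))\<^sup>2 + 2 * r * (u \<bullet> (x - s)) + r\<^sup>2"
    unfolding power2_norm_eq_inner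
    by (simp add: inner_add_left inner_add_right uu inner_commute power2_eq_square)
  also have "\<dots> \<le> r\<^sup>2 \<longleftrightarrow> u \<bullet> (x - s) \<le> - (1 / (2 * r)) * (norm (x - s))\<^sup>2"
    using assms(2) by (auto simp: field_simps)
  finally show ?thesis by simp
qed

lemma far_realized_iff_subset_cball:
  fixes \<zeta> :: "'a::real_inner"
  assumes "\<zeta> \<noteq> 0" and "r > 0"
  shows "far_realized r C s \<zeta> \<longleftrightarrow> C \<subseteq> cball (s - r *\<^sub>R (\<zeta> /\<^sub>R norm \<zeta>)) r"
proof -
  have "norm (\<zeta> /\<^sub>R norm \<zeta>) = 1"
    using assms(1) by simp
  from far_inequality_iff_cball[OF this assms(2)] show ?thesis
    unfolding far_realized_def by blast
qed

lemma far_realized_inner_neg: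
  fixes \<zeta> :: "'a::real_inner"
  assumes "far_realized r C s \<zeta>" and "\<zeta> \<noteq> 0" and "r > 0" and "x \<in> C" and "x \<noteq> s"
  shows "\<zeta> \<bullet> (x - s) < 0"
proof -
  have "(\<zeta> /\<^sub>R norm \<zeta>) \<bullet> (x - s) \<le> - (1 / (2 * r)) * (norm (x - s))\<^sup>2"
    using assms(1,4) unfolding far_realized_def by blast
  also have "\<dots> < 0"
    using assms(3,5) by simp
  finally have "(\<zeta> \<bullet> (x - s)) / norm \<zeta> < 0"
    by (simp add: divide_inverse mult.commute)
  then show ?thesis
    using assms(2) by (simp add: divide_less_0_iff)
qed

lemma far_realized_imp_proximal_normal:
  fixes \<zeta> :: "'a::real_inner"
  assumes "far_realized r C s \<zeta>" and "\<zeta> \<noteq> 0" and "r > 0"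
  shows "\<zeta> \<in> proximal_normal_cone C s"
proof -
  have "\<zeta> \<bullet> (x - s) \<le> 0 * (norm (x - s))\<^sup>2" if "x \<in> C" for x
    using far_realized_inner_neg[OF assms that] by (cases "x = s") auto
  then show ?thesis
    unfolding proximal_normal_cone_def by blast
qed

section \<open>Nearest points and their proximal normals\<close>

lemma nearest_point_in_frontier:
  fixes S :: "'a::real_normed_vector set"
  assumes "s \<in> S" and "x \<notin> S" and nearest: "\<And>y. y \<in> S \<Longrightarrow> dist x s \<le> dist x y"
  shows "s \<in> frontier S"
proof (rule ccontr)
  assume "s \<notin> frontier S"
  then have "s \<in> interior S"
    using assms(1) closure_subset unfolding frontier_def by blast
  then obtain e where "e > 0" and ball: "cball s e \<subseteq> S"
    using mem_interior_cball by blast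
  have far: "e < norm (x - s)"
    using ball assms(2) by (metis dist_commute dist_norm mem_cball not_le subsetD)
  \<comment> \<open>The point at distance \<open>e\<close> from \<open>s\<close> towards \<open>x\<close> lies in \<open>S\<close> and is nearer to \<open>x\<close>.\<close>
  define t where "t = e / norm (x - s)"
  have t: "0 < t" "t < 1" "t * norm (x - s) = e"
    using far \<open>e > 0\<close> less_trans[OF \<open>e > 0\<close> far] unfolding t_def
    by (auto simp: divide_less_eq intro: divide_pos_pos)
  define p where "p = s + t *\<^sub>R (x - s)"
  have "p \<in> S"
    using ball t unfolding p_def by (auto simp: dist_norm)
  have "x - p = (1 - t) *\<^sub>R (x - s)"
    unfolding p_def by (simp add: algebra_simps)
  then have "dist x p = (1 - t) * norm (x - s)"
    using t by (simp add: dist_norm)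
  also have "\<dots> < dist x s"
    using t \<open>e > 0\<close> by (simp add: dist_norm algebra_simps)
  finally show False
    using nearest[OF \<open>p \<in> S\<close>] by simp
qed

lemma nearest_point_proximal_normal:
  fixes S :: "'a::real_inner set"
  assumes nearest: "\<And>y. y \<in> S \<Longrightarrow> dist x s \<le> dist x y"
  shows "x - s \<in> proximal_normal_cone S s"
proof -
  have "(x - s) \<bullet> (y - s) \<le> 1/2 * (norm (y - s))\<^sup>2" if "y \<in> S" for y
  proof -
    have "(norm (x - s))\<^sup>2 \<le> (norm ((x - s) - (y - s)))\<^sup>2"
      using nearest[OF that] by (simp add: dist_norm)
    then show ?thesis
      unfolding power2_norm_eq_inner
      by (simp add: inner_diff_left inner_diff_right inner_commute)
  qed
  then show ?thesis
    unfolding proximal_normal_cone_def by (auto intro!: exI[of _ "1/2"])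
qed

lemma strongly_convex_nearest_point:
  fixes S :: "'a::euclidean_space set"
  assumes "strongly_convex r S" and "x \<notin> S"
  obtains s where "s \<in> S" "x \<noteq> s" "\<And>y. y \<in> S \<Longrightarrow> dist x s \<le> dist x y"
    "far_realized r S s (x - s)"
proof -
  have S: "S \<noteq> {}" "closed S"
    using assms(1) unfolding strongly_convex_def by auto
  obtain s where s: "s \<in> S" "\<And>y. y \<in> S \<Longrightarrow> dist x s \<le> dist x y"
    using distance_attains_inf[OF S(2) S(1), of x] by blast
  moreover have "x \<noteq> s"
    using s(1) assms(2) by blast
  moreover have "far_realized r S s (x - s)"
    using assms(1) nearest_point_in_frontier[OF s(1) assms(2) s(2)]
      nearest_point_proximal_normal[OF s(2)] \<open>x \<noteq> s\<close>
    unfolding strongly_convex_def by auto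
  ultimately show thesis
    using that by blast
qed

section \<open>Strongly convex sets are supported, bounded and solid\<close>

text \<open>
  Having a supporting ball of radius \<open>r\<close> is preserved under limits of the touching point: the set of
  pairs of a unit vector and a touching point is closed, and its projection along the compact unit
  sphere is closed.
\<close>

lemma closed_far_points:
  fixes S :: "'a::euclidean_space set"
  shows "closed {s. \<exists>u. u \<in> sphere 0 1 \<and> far_realized r S s u}"
proof -
  let ?T = "{(u, s). \<forall>x\<in>S. u \<bullet> (x - s) \<le> - (1 / (2 * r)) * (norm (x - s))\<^sup>2}"
  have "?T = (\<Inter>x\<in>S. {z. fst z \<bullet> (x - snd z) \<le> - (1 / (2 * r)) * (norm (x - snd z))\<^sup>2})"
    by auto
  also have "closed \<dots>"
    by (intro closed_INT ballI closed_Collect_le continuous_intros)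
  finally have "closed ?T" .
  from closed_compact_projection[OF compact_sphere this, of 0 1]
  have "closed {s. \<exists>u. u \<in> sphere 0 1 \<and> (u, s) \<in> ?T}" .
  also have "{s. \<exists>u. u \<in> sphere 0 1 \<and> (u, s) \<in> ?T} = {s. \<exists>u. u \<in> sphere 0 1 \<and> far_realized r S s u}"
    unfolding far_realized_def by auto
  finally show ?thesis .
qed

text \<open>
  Strong convexity constrains only the boundary points that have a nonzero proximal normal; the
  point of this lemma is that every boundary point has one.
\<close>

lemma strongly_convex_far_normal:
  fixes S :: "'a::euclidean_space set"
  assumes "strongly_convex r S" and "s \<in> frontier S"
  obtains u where "norm u = 1" "far_realized r S s u"
proof -
  let ?G = "{s. \<exists>u. u \<in> sphere 0 1 \<and> far_realized r S s u}"
  have "closed S"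
    using assms(1) unfolding strongly_convex_def by auto
  then have "s \<in> S"
    using assms(2) frontier_subset_closed by blast
  have "s \<in> closure ?G"
    unfolding closure_approachable
  proof (intro allI impI)
    fix e :: real assume "e > 0"
    have "s \<in> closure (- S)"
      using assms(2) frontier_closures by blast
    then obtain x where x: "x \<notin> S" "dist x s < e / 2"
      using \<open>e > 0\<close> by (metis ComplD closure_approachable half_gt_zero)
    obtain p where p: "p \<in> S" "x \<noteq> p" "\<And>y. y \<in> S \<Longrightarrow> dist x p \<le> dist x y"
      "far_realized r S p (x - p)"
      using strongly_convex_nearest_point[OF assms(1) x(1)] by blast
    have "far_realized r S p ((x - p) /\<^sub>R norm (x - p))" "norm ((x - p) /\<^sub>R norm (x - p)) = 1"
      using p(2,4) unfolding far_realized_def by auto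
    then have "p \<in> ?G"
      by (metis (mono_tags) mem_Collect_eq mem_sphere_0)
    moreover have "dist p s < e"
      using p(3)[OF \<open>s \<in> S\<close>] x(2) dist_triangle3[of p s x] by simp
    ultimately show "\<exists>p\<in>?G. dist p s < e"
      by blast
  qed
  then have "s \<in> ?G"
    using closed_far_points closure_closed by blast
  then show thesis
    using that by auto
qed

lemma strongly_convex_midpoint_mem:
  fixes S :: "'a::euclidean_space set"
  assumes "strongly_convex r S" and "r > 0" and "a \<in> S" and "b \<in> S"
  shows "midpoint a b \<in> S"
proof (rule ccontr)
  assume "midpoint a b \<notin> S"
  then obtain s where s: "midpoint a b \<noteq> s" "far_realized r S s (midpoint a b - s)"
    using strongly_convex_nearest_point[OF assms(1)] by metis
  let ?z = "midpoint a b - s"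
  have le: "?z \<bullet> (y - s) \<le> 0" if "y \<in> S" for y
    using far_realized_inner_neg[OF s(2) _ assms(2) that] s(1) by (cases "y = s") auto
  have "(a - s) + (b - s) = 2 *\<^sub>R ?z"
    by (simp add: midpoint_def algebra_simps scaleR_2)
  then have "?z \<bullet> (a - s) + ?z \<bullet> (b - s) = 2 * (?z \<bullet> ?z)"
    by (metis inner_add_right inner_scaleR_right)
  then have "?z \<bullet> ?z \<le> 0"
    using le[OF assms(3)] le[OF assms(4)] by linarith
  then show False
    using s(1) by (metis inner_gt_zero_iff not_le right_minus_eq)
qed

lemma strongly_convex_interior_nonempty:
  fixes S :: "'a::euclidean_space set"
  assumes "strongly_convex r S" and "r > 0" and "a \<in> S" and "b \<in> S" and "a \<noteq> b"
  shows "interior S \<noteq> {}"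
proof
  assume "interior S = {}"
  then have "midpoint a b \<in> frontier S"
    using strongly_convex_midpoint_mem[OF assms(1-4)] closure_subset
    unfolding frontier_def by auto
  then obtain u where u: "norm u = 1" "far_realized r S (midpoint a b) u"
    using strongly_convex_far_normal[OF assms(1)] by blast
  then have "u \<noteq> 0"
    by auto
  have "u \<bullet> (a - midpoint a b) < 0" "u \<bullet> (b - midpoint a b) < 0"
    using far_realized_inner_neg[OF u(2) \<open>u \<noteq> 0\<close> assms(2)] assms(3-5)
    by (metis midpoint_eq_endpoint)+
  moreover have "(a - midpoint a b) + (b - midpoint a b) = 0"
    by (simp add: midpoint_def algebra_simps) (simp flip: scaleR_add_left)
  then have "u \<bullet> (a - midpoint a b) + u \<bullet> (b - midpoint a b) = 0"
    by (metis inner_add_right inner_zero_right)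
  ultimately show False
    by linarith
qed

lemma strongly_convex_imp_bounded:
  fixes S :: "'a::euclidean_space set"
  assumes "strongly_convex r S" and "r > 0" and "S \<noteq> UNIV"
  shows "bounded S"
proof -
  have "frontier S \<noteq> {}"
    using assms(1,3) frontier_eq_empty unfolding strongly_convex_def by blast
  then obtain s u where "norm u = 1" "far_realized r S s u"
    using strongly_convex_far_normal[OF assms(1)] by blast
  moreover from this have "u \<noteq> 0"
    by auto
  ultimately have "S \<subseteq> cball (s - r *\<^sub>R (u /\<^sub>R norm u)) r"
    using far_realized_iff_subset_cball[OF _ assms(2)] by blast
  then show ?thesis
    using bounded_cball bounded_subset by blast
qed

lemma strongly_convex_imp_spherically_supported_frontier:
  fixes S :: "'a::euclidean_space set"
  assumes "strongly_convex r S" and "r > 0" and "S \<noteq> UNIV"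
  shows "spherically_supported r (frontier S)"
  unfolding spherically_supported_def
proof (intro conjI ballI)
  have S: "S \<noteq> {}" "closed S"
    using assms(1) unfolding strongly_convex_def by auto
  show "frontier S \<noteq> {}"
    using S assms(3) frontier_eq_empty by blast
  show "closed (frontier S)"
    by simp
  fix s assume "s \<in> frontier (frontier S)"
  then have "s \<in> frontier S"
    using frontier_subset_closed[of "frontier S"] by auto
  then obtain u where "norm u = 1" "far_realized r S s u"
    using strongly_convex_far_normal[OF assms(1)] by blast
  then have u: "u \<noteq> 0" "far_realized r (frontier S) s u"
    using frontier_subset_closed[OF S(2)] unfolding far_realized_def by auto
  then show "\<exists>\<zeta>\<in>proximal_normal_cone (frontier S) s. \<zeta> \<noteq> 0 \<and> far_realized r (frontier S) s \<zeta>"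
    using far_realized_imp_proximal_normal[OF u(2) u(1) assms(2)] by blast
qed

section \<open>Intersections of balls of radius r\<close>

text \<open>
  A quantitative form of the strict convexity of balls. By the parallelogram identity the squared
  distance of \<open>a + t (b - a)\<close> from the centre is at most \<open>r\<^sup>2 - 2 r q\<close>, where \<open>q\<close> is the radius of
  the small ball, and this is at most \<open>(r - q)\<^sup>2\<close>.
\<close>

lemma convex_combination_cball_subset:
  fixes a b c :: "'a::real_inner"
  assumes a: "a \<in> cball c r" and b: "b \<in> cball c r" and r: "r > 0" and t: "0 \<le> t" "t \<le> 1"
  shows "cball (a + t *\<^sub>R (b - a)) (t * (1 - t) * (norm (b - a))\<^sup>2 / (2 * r)) \<subseteq> cball c r"
proof
  define q where "q = t * (1 - t) * (norm (b - a))\<^sup>2 / (2 * r)"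
  define m where "m = a + t *\<^sub>R (b - a)"
  fix y assume "y \<in> cball (a + t *\<^sub>R (b - a)) (t * (1 - t) * (norm (b - a))\<^sup>2 / (2 * r))"
  then have y: "norm (y - m) \<le> q"
    unfolding q_def m_def by (simp add: dist_norm norm_minus_commute)
  have q: "2 * r * q = t * (1 - t) * (norm (b - a))\<^sup>2"
    using r unfolding q_def by simp
  have sq: "(norm (a - c))\<^sup>2 \<le> r\<^sup>2" "(norm (b - c))\<^sup>2 \<le> r\<^sup>2"
    using a b by (auto simp: dist_norm norm_minus_commute intro!: power_mono)
  have identity: "(norm (A + t *\<^sub>R (B - A)))\<^sup>2
      = (1 - t) * (norm A)\<^sup>2 + t * (norm B)\<^sup>2 - t * (1 - t) * (norm (B - A))\<^sup>2" for A B :: 'a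
    unfolding power2_norm_eq_inner
    by (simp add: inner_add_left inner_add_right inner_diff_left inner_diff_right
        inner_commute) (simp add: algebra_simps)
  have "m - c = (a - c) + t *\<^sub>R ((b - c) - (a - c))"
    unfolding m_def by (simp add: algebra_simps)
  moreover have "(b - c) - (a - c) = b - a"
    by simp
  ultimately have "(norm (m - c))\<^sup>2
      = (1 - t) * (norm (a - c))\<^sup>2 + t * (norm (b - c))\<^sup>2 - t * (1 - t) * (norm (b - a))\<^sup>2"
    using identity[of "a - c" "b - c"] by metis
  also have "\<dots> \<le> (1 - t) * r\<^sup>2 + t * r\<^sup>2 - t * (1 - t) * (norm (b - a))\<^sup>2"
    using sq t by (intro diff_right_mono add_mono mult_left_mono) auto
  also have "\<dots> = r * (r - 2 * q)"
    using q by (simp add: algebra_simps power2_eq_square)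
  finally have m: "(norm (m - c))\<^sup>2 \<le> r * (r - 2 * q)" .
  then have "0 \<le> r * (r - 2 * q)"
    using zero_le_power2 order_trans by blast
  then have "2 * q \<le> r"
    using r by (simp add: zero_le_mult_iff)
  have "r * (r - 2 * q) \<le> (r - q)\<^sup>2"
    by (simp add: power2_eq_square algebra_simps)
  with m have "(norm (m - c))\<^sup>2 \<le> (r - q)\<^sup>2"
    by (rule order_trans)
  then have "norm (m - c) \<le> r - q"
    by (rule power2_le_imp_le) (use \<open>2 * q \<le> r\<close> r in linarith)
  then have "norm (y - c) \<le> r"
    using y norm_triangle_ineq[of "y - m" "m - c"] by simp
  then show "y \<in> cball c r"
    by (simp add: dist_norm norm_minus_commute)
qed

text \<open>
  Near \<open>s\<close> the small balls around \<open>s + t (b - s)\<close> have radius of order \<open>t\<close>, whereas the error term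
  of the proximal inequality is of order \<open>t\<^sup>2\<close>; the first-order parts alone must satisfy the
  inequality, and they form the far realization inequality at \<open>b\<close>.
\<close>

lemma far_realized_if_convex_combination_cballs:
  fixes S :: "'a::real_inner set"
  assumes "\<zeta> \<in> proximal_normal_cone S s" and "\<zeta> \<noteq> 0" and r: "r > 0"
    and balls: "\<And>b t. b \<in> S \<Longrightarrow> 0 < t \<Longrightarrow> t < 1 \<Longrightarrow>
      cball (s + t *\<^sub>R (b - s)) (t * (1 - t) * (norm (b - s))\<^sup>2 / (2 * r)) \<subseteq> S"
  shows "far_realized r S s \<zeta>"
  unfolding far_realized_def
proof
  fix b assume "b \<in> S"
  obtain \<sigma> where \<sigma>: "\<sigma> \<ge> 0" "\<And>x. x \<in> S \<Longrightarrow> \<zeta> \<bullet> (x - s) \<le> \<sigma> * (norm (x - s))\<^sup>2"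
    using assms(1) unfolding proximal_normal_cone_def by blast
  define u where "u = \<zeta> /\<^sub>R norm \<zeta>"
  have u: "norm u = 1" "\<zeta> \<bullet> u = norm \<zeta>"
    using assms(2) unfolding u_def by (auto simp: dot_square_norm power2_eq_square)
  define \<beta> where "\<beta> = (norm (b - s))\<^sup>2 / (2 * r)"
  have "\<beta> \<ge> 0"
    using r unfolding \<beta>_def by simp
  define K where "K = norm (b - s) + \<beta>"
  have first_order: "\<zeta> \<bullet> (b - s) + (1 - t) * \<beta> * norm \<zeta> \<le> \<sigma> * K\<^sup>2 * t" if t: "0 < t" "t < 1" for t
  proof -
    \<comment> \<open>the point of the small ball that is farthest in the direction of the normal\<close>
    define p where "p = s + t *\<^sub>R (b - s) + (t * (1 - t) * \<beta>) *\<^sub>R u"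
    have "p \<in> cball (s + t *\<^sub>R (b - s)) (t * (1 - t) * (norm (b - s))\<^sup>2 / (2 * r))"
      using t r u(1) unfolding p_def \<beta>_def by (simp add: dist_norm)
    then have "p \<in> S"
      using balls[OF \<open>b \<in> S\<close> t] by blast
    have ps: "p - s = t *\<^sub>R ((b - s) + ((1 - t) * \<beta>) *\<^sub>R u)"
      unfolding p_def by (simp add: algebra_simps)
    have "norm ((b - s) + ((1 - t) * \<beta>) *\<^sub>R u) \<le> norm (b - s) + (1 - t) * \<beta>"
      using norm_triangle_ineq[of "b - s" "((1 - t) * \<beta>) *\<^sub>R u"] t \<open>\<beta> \<ge> 0\<close> u(1) by simp
    also have "\<dots> \<le> K"
      using t \<open>\<beta> \<ge> 0\<close> unfolding K_def by (simp add: mult_left_le_one_le)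
    finally have "norm (p - s) \<le> t * K"
      using t unfolding ps by simp
    then have "(norm (p - s))\<^sup>2 \<le> (t * K)\<^sup>2"
      by (intro power_mono) auto
    then have "\<zeta> \<bullet> (p - s) \<le> \<sigma> * (t * K)\<^sup>2"
      using \<sigma>(2)[OF \<open>p \<in> S\<close>] \<sigma>(1) by (meson mult_left_mono order_trans)
    then have "t * (\<zeta> \<bullet> (b - s) + (1 - t) * \<beta> * norm \<zeta>) \<le> t * (\<sigma> * K\<^sup>2 * t)"
      unfolding ps by (simp add: inner_add_right u(2) power2_eq_square algebra_simps)
    then show ?thesis
      using t(1) by simp
  qed
  have "\<zeta> \<bullet> (b - s) + (1 - 0) * \<beta> * norm \<zeta> \<le> \<sigma> * K\<^sup>2 * 0"
  proof (rule tendsto_le)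
    show "((\<lambda>t. \<sigma> * K\<^sup>2 * t) \<longlongrightarrow> \<sigma> * K\<^sup>2 * 0) (at_right 0)"
      by (intro tendsto_intros)
    show "((\<lambda>t. \<zeta> \<bullet> (b - s) + (1 - t) * \<beta> * norm \<zeta>)
        \<longlongrightarrow> \<zeta> \<bullet> (b - s) + (1 - 0) * \<beta> * norm \<zeta>) (at_right 0)"
      by (intro tendsto_intros)
    show "\<forall>\<^sub>F t in at_right 0. \<zeta> \<bullet> (b - s) + (1 - t) * \<beta> * norm \<zeta> \<le> \<sigma> * K\<^sup>2 * t"
      using first_order eventually_at_right_less[of "0::real"]
      by (auto simp: eventually_at_right_field intro!: exI[of _ 1])
  qed simp
  then have "(\<zeta> \<bullet> (b - s)) / norm \<zeta> \<le> - \<beta>"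
    using assms(2) by (simp add: divide_le_eq)
  moreover have "(\<zeta> /\<^sub>R norm \<zeta>) \<bullet> (b - s) = (\<zeta> \<bullet> (b - s)) / norm \<zeta>"
    by (simp add: divide_inverse mult.commute)
  ultimately show "(\<zeta> /\<^sub>R norm \<zeta>) \<bullet> (b - s) \<le> - (1 / (2 * r)) * (norm (b - s))\<^sup>2"
    unfolding \<beta>_def by simp
qed

section \<open>From a supported boundary to strong convexity\<close>

lemma frontier_frontier_closed:
  assumes "closed S"
  shows "frontier (frontier S) = frontier S"
proof -
  have "interior (frontier S) \<subseteq> interior S"
    by (intro interior_mono frontier_subset_closed assms)
  then have "interior (frontier S) = {}"
    using interior_subset[of "frontier S"] unfolding frontier_def by blast
  then show ?thesis
    using frontier_def[of "frontier S"] by simp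
qed

text \<open>
  A point of \<open>S\<close> at maximal distance from the centre cannot be interior, since it could be moved
  further outwards.
\<close>

lemma subset_cball_if_frontier_subset:
  fixes S :: "'a::euclidean_space set"
  assumes "compact S" and "frontier S \<subseteq> cball c r" and "r \<ge> 0"
  shows "S \<subseteq> cball c r"
proof (rule ccontr)
  assume "\<not> S \<subseteq> cball c r"
  then obtain x where x: "x \<in> S" "dist c x > r"
    by (meson mem_cball not_le subsetI)
  then obtain y where y: "y \<in> S" "\<And>z. z \<in> S \<Longrightarrow> dist c z \<le> dist c y"
    using distance_attains_sup[OF assms(1), of c] by blast
  then have far: "norm (y - c) > r"
    using x by (metis dist_commute dist_norm less_le_trans)
  then have "y \<notin> frontier S"
    using assms(2) by (auto simp: dist_norm norm_minus_commute)
  then have "y \<in> interior S"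
    using y(1) closure_subset unfolding frontier_def by blast
  then obtain e where "e > 0" and ball: "cball y e \<subseteq> S"
    using mem_interior_cball by blast
  define t where "t = e / norm (y - c)"
  have t: "t > 0" "t * norm (y - c) = e"
    using le_less_trans[OF assms(3) far] \<open>e > 0\<close> unfolding t_def
    by (auto intro: divide_pos_pos)
  define z where "z = y + t *\<^sub>R (y - c)"
  have "z \<in> S"
    using ball t unfolding z_def by (auto simp: dist_norm)
  have "z - c = (1 + t) *\<^sub>R (y - c)"
    unfolding z_def by (simp add: algebra_simps)
  then have "norm (z - c) = (1 + t) * norm (y - c)"
    using t(1) by simp
  also have "\<dots> = norm (y - c) + e"
    using t(2) by (simp add: distrib_right)
  finally have "norm (z - c) = norm (y - c) + e" .
  then show False
    using y(2)[OF \<open>z \<in> S\<close>] \<open>e > 0\<close> by (simp add: dist_norm norm_minus_commute)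
qed

lemma spherically_supported_frontier_far_normal:
  fixes S :: "'a::euclidean_space set"
  assumes "compact S" and "spherically_supported r (frontier S)" and "r > 0" and "s \<in> frontier S"
  obtains \<zeta> where "\<zeta> \<noteq> 0" "far_realized r S s \<zeta>"
proof -
  have "s \<in> frontier (frontier S)"
    using assms(4) frontier_frontier_closed[OF compact_imp_closed[OF assms(1)]] by simp
  then obtain \<zeta> where \<zeta>: "\<zeta> \<noteq> 0" "far_realized r (frontier S) s \<zeta>"
    using assms(2) unfolding spherically_supported_def by blast
  then have "far_realized r S s \<zeta>"
    using subset_cball_if_frontier_subset[OF assms(1)] assms(3)
    by (simp add: far_realized_iff_subset_cball)
  with \<zeta>(1) show thesis
    using that by blast
qed

text \<open>
  The supporting half space at a boundary point of the segment from an interior point \<open>y\<close> to \<open>x\<close>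
  contains \<open>y\<close> strictly inside, hence excludes \<open>x\<close>, and the supporting ball is contained in it.
\<close>

lemma separating_cball:
  fixes S :: "'a::euclidean_space set"
  assumes "compact S" and "spherically_supported r (frontier S)" and "r > 0"
    and "interior S \<noteq> {}" and "x \<notin> S"
  obtains c where "S \<subseteq> cball c r" "x \<notin> cball c r"
proof -
  obtain y where y: "y \<in> interior S"
    using assms(4) by blast
  then have "y \<in> S"
    using interior_subset by blast
  have "closed_segment y x \<inter> frontier S \<noteq> {}"
    using \<open>y \<in> S\<close> assms(5) by (intro connected_Int_frontier) auto
  then obtain s where s: "s \<in> closed_segment y x" "s \<in> frontier S"
    by blast
  then have "s \<in> S" "s \<noteq> y"
    using frontier_subset_closed[OF compact_imp_closed[OF assms(1)]] y
    unfolding frontier_def by auto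
  obtain t where t: "0 \<le> t" "t \<le> 1" "s = (1 - t) *\<^sub>R y + t *\<^sub>R x"
    using s(1) unfolding closed_segment_def by blast
  then have "t < 1"
    using \<open>s \<in> S\<close> assms(5) by (cases "t = 1") auto
  have "x \<noteq> s"
    using \<open>s \<in> S\<close> assms(5) by blast
  obtain \<zeta> where \<zeta>: "\<zeta> \<noteq> 0" "far_realized r S s \<zeta>"
    using spherically_supported_frontier_far_normal[OF assms(1-3) s(2)] by blast
  have S: "S \<subseteq> cball (s - r *\<^sub>R (\<zeta> /\<^sub>R norm \<zeta>)) r"
    using far_realized_iff_subset_cball[OF \<zeta>(1) assms(3)] \<zeta>(2) by blast
  have "x \<notin> cball (s - r *\<^sub>R (\<zeta> /\<^sub>R norm \<zeta>)) r"
  proof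
    assume "x \<in> cball (s - r *\<^sub>R (\<zeta> /\<^sub>R norm \<zeta>)) r"
    then have "far_realized r {x} s \<zeta>"
      using far_realized_iff_subset_cball[OF \<zeta>(1) assms(3)] by blast
    then have x: "\<zeta> \<bullet> (x - s) < 0"
      using far_realized_inner_neg \<zeta>(1) assms(3) \<open>x \<noteq> s\<close> by blast
    have "(1 - t) *\<^sub>R (y - s) + t *\<^sub>R (x - s) = 0"
      unfolding t(3) by (simp add: algebra_simps)
    then have "(1 - t) * (\<zeta> \<bullet> (y - s)) + t * (\<zeta> \<bullet> (x - s)) = 0"
      by (metis inner_add_right inner_scaleR_right inner_zero_right)
    moreover have "(1 - t) * (\<zeta> \<bullet> (y - s)) < 0"
      using far_realized_inner_neg[OF \<zeta>(2,1) assms(3) \<open>y \<in> S\<close>] \<open>s \<noteq> y\<close> \<open>t < 1\<close>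
      by (simp add: mult_pos_neg)
    moreover have "t * (\<zeta> \<bullet> (x - s)) \<le> 0"
      using x t(1) by (simp add: mult_nonneg_nonpos)
    ultimately show False
      by linarith
  qed
  with S show thesis
    using that by blast
qed

lemma strongly_convex_if_spherically_supported_frontier:
  fixes S :: "'a::euclidean_space set"
  assumes "compact S" and "r > 0" and "interior S \<noteq> {}" and "spherically_supported r (frontier S)"
  shows "strongly_convex r S"
  unfolding strongly_convex_def
proof (intro conjI ballI impI)
  show "S \<noteq> {}"
    using assms(3) by auto
  show "closed S"
    using assms(1) by (rule compact_imp_closed)
  fix s \<zeta> assume s: "s \<in> frontier S" and \<zeta>: "\<zeta> \<in> proximal_normal_cone S s" "\<zeta> \<noteq> 0"
  have "s \<in> S"
    using s frontier_subset_closed[OF \<open>closed S\<close>] by blast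
  show "far_realized r S s \<zeta>"
  proof (rule far_realized_if_convex_combination_cballs[OF \<zeta> assms(2)])
    fix b t assume "b \<in> S" and t: "0 < t" "t < (1::real)"
    show "cball (s + t *\<^sub>R (b - s)) (t * (1 - t) * (norm (b - s))\<^sup>2 / (2 * r)) \<subseteq> S"
    proof
      fix y assume y: "y \<in> cball (s + t *\<^sub>R (b - s)) (t * (1 - t) * (norm (b - s))\<^sup>2 / (2 * r))"
      show "y \<in> S"
      proof (rule ccontr)
        assume "y \<notin> S"
        then obtain c where c: "S \<subseteq> cball c r" "y \<notin> cball c r"
          using separating_cball[OF assms(1,4,2,3)] by blast
        then have "s \<in> cball c r" "b \<in> cball c r"
          using \<open>s \<in> S\<close> \<open>b \<in> S\<close> by blast+
        then have "y \<in> cball c r"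
          using convex_combination_cball_subset[of s c r b t] assms(2) t y by (meson less_imp_le subsetD)
        with c(2) show False
          by blast
      qed
    qed
  qed
qed

section \<open>The characterization\<close>

theorem theorem4:
  fixes S :: "(real ^ 'n) set" and r :: real
  assumes "S \<noteq> {}" and "closed S" and "\<nexists>a. S = {a}" and "S \<noteq> UNIV" and "r > 0"
  shows "strongly_convex r S \<longleftrightarrow>
    bounded S \<and> interior S \<noteq> {} \<and> spherically_supported r (frontier S)"
proof
  assume S: "strongly_convex r S"
  obtain a b where "a \<in> S" "b \<in> S" "a \<noteq> b"
    using assms(1,3) by blast
  then show "bounded S \<and> interior S \<noteq> {} \<and> spherically_supported r (frontier S)"
    using strongly_convex_imp_bounded[OF S assms(5,4)]
      strongly_convex_interior_nonempty[OF S assms(5)]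
      strongly_convex_imp_spherically_supported_frontier[OF S assms(5,4)] by blast
next
  assume "bounded S \<and> interior S \<noteq> {} \<and> spherically_supported r (frontier S)"
  then show "strongly_convex r S"
    using strongly_convex_if_spherically_supported_frontier[OF _ assms(5)] assms(2)
      compact_eq_bounded_closed by blast
qed

end
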